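(* Let $\mathcal{A}$ be a finite alphabet. Given a subset $X$ of $\mathcal{A}^{\mathbb{N}}$, let $\overline{X}$ denote its topological closure in the product topology on $\mathcal{A}^{\mathbb{N}}$ (each copy of $\mathcal{A}$ being discrete). (1) For each $n\ge1$ and $j\ge0$, $\psi_{j,n}(\overline{X})=\overline{\psi_{j,n}(X)}$. In particular, if $X$ is a closed set in $\mathcal{A}^{\mathbb{N}}$, then each decimation $\psi_{j,n}(X)$ is a closed set. (2) For $X_0,X_1,\dots,X_{n-1}\subseteq\mathcal{A}^{\mathbb{N}}$, there holds $(\circledast_n)_{j=0}^{n-1}\overline{X_j}=\overline{(\circledast_n)_{j=0}^{n-1}X_j}$. In particular, the $n$-fold interleaving of closed sets is a closed set. (3) The $n$-fold interleaving closure operation commutes with topological closure: $(\overline{X})^{[n]}=\overline{X^{[n]}}$. (4) The shift operator commutes with topological closure: $S\overline{X}=\overline{SX}$.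
   Context: $\mathbb{N}=\{0,1,2,\dots\}$. The shift is $S(a_0a_1a_2\cdots)=a_1a_2a_3\cdots$, applied elementwise to sets. For $\mathbf{x}=a_0a_1a_2\cdots\in\mathcal{A}^{\mathbb{N}}$, $i\ge0$, $n\ge1$, the decimation is $\psi_{i,n}(\mathbf{x})=a_ia_{i+n}a_{i+2n}\cdots$, and $\psi_{i,n}(X)=\{\psi_{i,n}(\mathbf{x}):\mathbf{x}\in X\}$. The $n$-fold interleaving of sequences $\mathbf{x}_i=a_{i,0}a_{i,1}\cdots$ ($0\le i\le n-1$) is $b_0b_1b_2\cdots$ with $b_{i+jn}=a_{i,j}$ ($0\le i\le n-1$, $j\ge0$); the $n$-fold interleaving $(\circledast_n)_{i=0}^{n-1}X_i$ of sets is the set of all $n$-fold interleavings of $(\mathbf{x}_0,\dots,\mathbf{x}_{n-1})$ with $\mathbf{x}_i\in X_i$. The $n$-fold interleaving closure of $X$ is $X^{[n]}=(\circledast_n)_{i=0}^{n-1}\psi_{i,n}(X)$. *)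

theory Defs
  imports "HOL-Analysis.Analysis"
begin

definition seq_space :: "'a set \<Rightarrow> (nat \<Rightarrow> 'a) topology" where
  "seq_space A = product_topology (\<lambda>_. discrete_topology A) UNIV"

lemma topspace_seq_space: "topspace (seq_space A) = {x. \<forall>k. x k \<in> A}"
  by (auto simp: seq_space_def PiE_iff)

definition shift :: "(nat \<Rightarrow> 'a) \<Rightarrow> nat \<Rightarrow> 'a" where
  "shift x = (\<lambda>k. x (k + 1))"

definition decimation :: "nat \<Rightarrow> nat \<Rightarrow> (nat \<Rightarrow> 'a) \<Rightarrow> nat \<Rightarrow> 'a" where
  "decimation i n x = (\<lambda>j. x (i + j * n))"

text \<open>For \<open>n \<ge> 1\<close> every index is \<open>i + j * n\<close> for exactly one pair with \<open>i < n\<close>, so the sequences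
  \<open>x i\<close> (\<open>i < n\<close>) have exactly one interleaving. The values of \<open>x\<close> and \<open>X\<close> at arguments
  \<open>i \<ge> n\<close> are irrelevant. The case \<open>n = 0\<close> is meaningless.\<close>

definition is_interleaving :: "nat \<Rightarrow> (nat \<Rightarrow> nat \<Rightarrow> 'a) \<Rightarrow> (nat \<Rightarrow> 'a) \<Rightarrow> bool" where
  "is_interleaving n x b \<longleftrightarrow> (\<forall>i<n. \<forall>j. b (i + j * n) = x i j)"

definition interleaving :: "nat \<Rightarrow> (nat \<Rightarrow> (nat \<Rightarrow> 'a) set) \<Rightarrow> (nat \<Rightarrow> 'a) set" where
  "interleaving n X = {b. \<exists>x. (\<forall>i<n. x i \<in> X i) \<and> is_interleaving n x b}"

definition interleaving_closure :: "nat \<Rightarrow> (nat \<Rightarrow> 'a) set \<Rightarrow> (nat \<Rightarrow> 'a) set" where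
  "interleaving_closure n X = interleaving n (\<lambda>i. decimation i n ` X)"

end

theory Submission
  imports Defs
begin

text \<open>Since the alphabet is finite, the sequence space is compact and Hausdorff, so continuous maps
  into it from compact spaces are closed and hence commute with closures. Decimations and the shift
  (which is a decimation) are continuous self-maps, and interleaving is a continuous map from the
  product of \<open>n\<close> copies of the sequence space, in which the closure of a box is the box of the
  closures.\<close>

lemma compact_space_seq_space: "finite A \<Longrightarrow> compact_space (seq_space A)"
  by (auto simp: seq_space_def compact_space_product_topology compact_space_discrete_topology)

lemma Hausdorff_space_seq_space: "Hausdorff_space (seq_space A)"
  by (auto simp: seq_space_def Hausdorff_space_product_topology)

lemma continuous_map_seq_space_nth:
  "continuous_map (seq_space A) (discrete_topology A) (\<lambda>x. x k)"
  using continuous_map_product_projection[of k UNIV "\<lambda>_. discrete_topology A"]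
  by (simp add: seq_space_def)

lemma continuous_map_into_seq_space:
  "continuous_map T (seq_space A) f \<longleftrightarrow> (\<forall>k. continuous_map T (discrete_topology A) (\<lambda>x. f x k))"
  by (simp add: seq_space_def continuous_map_componentwise_UNIV)

lemma closure_of_image_seq_space:
  assumes "compact_space T" and f: "continuous_map T (seq_space A) f" and "S \<subseteq> topspace T"
  shows "f ` (T closure_of S) = seq_space A closure_of (f ` S)"
proof -
  have "closed_map T (seq_space A) f"
    using f assms(1) Hausdorff_space_seq_space by (rule T1_Spaces.continuous_imp_closed_map)
  then show ?thesis
    by (metis assms(3) f closed_map_closure_of_image closure_of_minimal continuous_map_image_closure_subset subset_antisym)
qed

lemma continuous_map_decimation: "continuous_map (seq_space A) (seq_space A) (decimation j n)"
  by (simp add: continuous_map_into_seq_space continuous_map_seq_space_nth decimation_def)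

lemma shift_eq_decimation: "shift = decimation 1 1"
  by (simp add: shift_def decimation_def fun_eq_iff)

text \<open>Division with remainder, \<open>k = k mod n + k div n * n\<close>, solves the defining
  relation for \<open>b\<close>. This exhibits an interleaving of sets as the image of a box under a
  single map, the form that \<open>closure_of_image_seq_space\<close> requires.\<close>

lemma interleaving_eq_image:
  assumes "n \<ge> 1"
  shows "interleaving n X = (\<lambda>x k. x (k mod n) (k div n)) ` PiE {..<n} X"
    (is "_ = ?f ` _")
proof (intro set_eqI iffI)
  fix b assume "b \<in> interleaving n X"
  then obtain x where x: "\<And>i. i < n \<Longrightarrow> x i \<in> X i" and b: "is_interleaving n x b"
    by (auto simp: interleaving_def)
  \<comment> \<open>The witness \<open>x\<close> is arbitrary at indices from \<open>n\<close> on,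
    whereas members of \<open>PiE\<close> are \<open>undefined\<close> there; hence the
    restriction.\<close>
  have "b = ?f (restrict x {..<n})"
  proof
    fix k
    have "k mod n < n" using assms by simp
    then have "b (k mod n + k div n * n) = x (k mod n) (k div n)"
      using b unfolding is_interleaving_def by blast
    then show "b k = ?f (restrict x {..<n}) k"
      using \<open>k mod n < n\<close> by simp
  qed
  then show "b \<in> ?f ` PiE {..<n} X"
    using x by (intro image_eqI) auto
next
  fix b assume "b \<in> ?f ` PiE {..<n} X"
  then show "b \<in> interleaving n X"
    by (force simp: interleaving_def is_interleaving_def PiE_iff)
qed

lemma closure_of_interleaving:
  assumes "finite A" "n \<ge> 1" "\<And>i. i < n \<Longrightarrow> X i \<subseteq> topspace (seq_space A)"
  shows "interleaving n (\<lambda>i. seq_space A closure_of X i) = seq_space A closure_of (interleaving n X)"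
proof -
  let ?T = "product_topology (\<lambda>_. seq_space A) {..<n}"
  let ?f = "\<lambda>x k. x (k mod n) (k div n)"
  \<comment> \<open>Coordinate \<open>k\<close> of \<open>?f\<close> is the projection to factor
    \<open>k mod n\<close>, an index of the product because \<open>n \<ge> 1\<close>, followed by
    evaluation at \<open>k div n\<close>.\<close>
  have "continuous_map ?T (discrete_topology A) (\<lambda>x. x (k mod n) (k div n))" for k
  proof -
    have "continuous_map ?T (seq_space A) (\<lambda>x. x (k mod n))"
      using assms(2) continuous_map_product_projection[of "k mod n" "{..<n}" "\<lambda>_. seq_space A"]
      by simp
    from continuous_map_compose[OF this continuous_map_seq_space_nth] show ?thesis
      by (simp add: o_def)
  qed
  then have "continuous_map ?T (seq_space A) ?f"
    by (simp add: continuous_map_into_seq_space)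
  moreover have "compact_space ?T"
    by (simp add: compact_space_product_topology compact_space_seq_space assms(1))
  moreover have "PiE {..<n} X \<subseteq> topspace ?T"
    using assms(3) by (simp add: subset_PiE)
  ultimately have "?f ` (?T closure_of PiE {..<n} X) = seq_space A closure_of (?f ` PiE {..<n} X)"
    by (intro closure_of_image_seq_space)
  \<comment> \<open>Both interleavings become images of boxes under \<open>?f\<close>, and the
    closure of a box is the box of the closures.\<close>
  then show ?thesis
    by (simp only: interleaving_eq_image[OF assms(2)] closure_of_product_topology)
qed

theorem theorem4p12:
  fixes A :: "'a set"
  assumes "finite A"
  shows
    "(\<forall>X n j. X \<subseteq> topspace (seq_space A) \<and> n \<ge> 1 \<longrightarrow>
        decimation j n ` (seq_space A closure_of X) = seq_space A closure_of (decimation j n ` X)) \<and>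
     (\<forall>X n j. closedin (seq_space A) X \<and> n \<ge> 1 \<longrightarrow>
        closedin (seq_space A) (decimation j n ` X)) \<and>
     (\<forall>n X. n \<ge> 1 \<and> (\<forall>i<n. X i \<subseteq> topspace (seq_space A)) \<longrightarrow>
        interleaving n (\<lambda>i. seq_space A closure_of X i) = seq_space A closure_of (interleaving n X)) \<and>
     (\<forall>n X. n \<ge> 1 \<and> (\<forall>i<n. closedin (seq_space A) (X i)) \<longrightarrow>
        closedin (seq_space A) (interleaving n X)) \<and>
     (\<forall>X n. X \<subseteq> topspace (seq_space A) \<and> n \<ge> 1 \<longrightarrow>
        interleaving_closure n (seq_space A closure_of X) =
        seq_space A closure_of (interleaving_closure n X)) \<and>
     (\<forall>X. X \<subseteq> topspace (seq_space A) \<longrightarrow>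
        shift ` (seq_space A closure_of X) = seq_space A closure_of (shift ` X))"
proof -
  note compact = compact_space_seq_space[OF assms]
  have dec: "decimation j n ` (seq_space A closure_of X) = seq_space A closure_of (decimation j n ` X)"
    if "X \<subseteq> topspace (seq_space A)" for X j n
    using closure_of_image_seq_space[OF compact continuous_map_decimation that] .
  have dec_closed: "closedin (seq_space A) (decimation j n ` X)"
    if "closedin (seq_space A) X" for X j n
    using dec[OF closedin_subset[OF that]] that by (metis closedin_closure_of closure_of_closedin)
  have int_closed: "closedin (seq_space A) (interleaving n X)"
    if "n \<ge> 1" "\<forall>i<n. closedin (seq_space A) (X i)" for n X
  proof -
    \<comment> \<open>The two families may differ at indices from \<open>n\<close> on, so the
      definition is unfolded to expose the bound \<open>i < n\<close>.\<close>
    have "interleaving n X = interleaving n (\<lambda>i. seq_space A closure_of X i)"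
      unfolding interleaving_def using that(2) by (simp add: closure_of_closedin cong: conj_cong)
    also have "\<dots> = seq_space A closure_of (interleaving n X)"
      using that by (intro closure_of_interleaving assms closedin_subset) auto
    finally show ?thesis
      by (metis closedin_closure_of)
  qed
  have "interleaving_closure n (seq_space A closure_of X) =
      seq_space A closure_of (interleaving_closure n X)"
    if X: "X \<subseteq> topspace (seq_space A)" and "n \<ge> 1" for X n
    \<comment> \<open>Rewriting with \<open>dec\<close> turns the decimations of the closure into
      closures of decimations. These decimations stay inside the space, so
      \<open>closure_of_interleaving\<close> applies to them.\<close>
    unfolding interleaving_closure_def dec[OF X]
    using X continuous_map_image_subset_topspace[OF continuous_map_decimation]
    by (intro closure_of_interleaving assms that(2)) blast
  then show ?thesis
    using dec dec_closed int_closed closure_of_interleaving[OF assms]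
    by (simp add: shift_eq_decimation)
qed

end
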